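(* Let $X$ be a finite dimensional real Banach space with a polyhedral norm and suppose that $f: X \to X$ is nonexpansive. For every nonempty proper face $F$ of the closed unit ball $B_1$ of $X$, choose a point $x_F$ in the relative interior of $F$ and a functional $x_F^*$ in the relative interior of the corresponding dual face $F^*$ of the dual unit ball $B_1^*$. Then $f-\mathrm{id}$ maps $X$ onto $X$ if and only if $$\lim_{t \to \infty} \langle f(t x_F) - t x_F, x_F^* \rangle = -\infty$$ for every nonempty proper face $F$ of $B_1$.
   Context: A map $f:X\to X$ is nonexpansive if $\|f(x)-f(y)\|\le\|x-y\|$ for all $x,y\in X$; $\mathrm{id}$ is the identity map. $X^*$ is the dual space with dual norm $\|\cdot\|_*$, $\langle x,x^*\rangle$ is the value of $x^*\in X^*$ at $x\in X$, $B_1$ and $B_1^*$ are the closed unit balls of $X$ and $X^*$. A norm is polyhedral if $B_1$ has finitely many extreme points. A convex subset $F$ of a convex set $C$ is a face of $C$ if $tx+(1-t)y\in F$ with $x,y\in C$ and $0<t<1$ implies $x,y\in F$; it is a proper face if $F\neq C$. The duality map is $J(x)=\{x^*\in X^*:\|x^*\|_*=\|x\|,\ \langle x,x^*\rangle=\|x\|\,\|x^*\|_*\}$. For a proper face $F$ of $B_1$, the dual face $F^*$ is the image of the relative interior of $F$ under $J$. *)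

theory Defs
  imports "HOL-Analysis.Analysis"
begin

text \<open>The dual space of \<open>'a\<close> is the type \<open>'a \<Rightarrow>\<^sub>L real\<close>, whose norm is the operator norm,
  so that \<open>cball 0 1\<close> at this type is the dual unit ball.\<close>

definition finite_dim_space :: "'a::real_normed_vector itself \<Rightarrow> bool" where
  "finite_dim_space _ \<longleftrightarrow> (\<exists>B::'a set. finite B \<and> span B = UNIV)"

definition polyhedral_norm :: "'a::real_normed_vector itself \<Rightarrow> bool" where
  "polyhedral_norm _ \<longleftrightarrow> finite {x::'a. x extreme_point_of cball 0 1}"

definition nonexpansive :: "('a::real_normed_vector \<Rightarrow> 'a) \<Rightarrow> bool" where
  "nonexpansive f \<longleftrightarrow> (\<forall>x y. norm (f x - f y) \<le> norm (x - y))"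

definition duality_map :: "'a::real_normed_vector \<Rightarrow> ('a \<Rightarrow>\<^sub>L real) set" where
  "duality_map x = {\<phi>. norm \<phi> = norm x \<and> blinfun_apply \<phi> x = norm x * norm \<phi>}"

text \<open>The duality map is set-valued, so the image of a set under it is a union.\<close>

definition dual_face :: "'a::real_normed_vector set \<Rightarrow> ('a \<Rightarrow>\<^sub>L real) set" where
  "dual_face F = (\<Union>x \<in> rel_interior F. duality_map x)"

text \<open>The library notion \<open>face_of\<close> admits the empty set and the whole ball, which are excluded here.\<close>

definition proper_faces :: "'a::real_normed_vector set set" where
  "proper_faces = {F. F face_of cball 0 1 \<and> F \<noteq> {} \<and> F \<noteq> cball 0 1}"

end

theory Submission
  imports Defs
begin

text \<open>
  A polyhedral norm is the maximum of a finite set \<open>E\<close> of functionals. For a unit vector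
  \<open>x\<close>, the members of \<open>E\<close> that take the value \<open>1\<close> at \<open>x\<close> are called active. Their
  convex hull is the dual face of the face that has \<open>x\<close> in its relative interior, and no
  further functionals become active near \<open>x\<close> (\<open>eventually_active_subset\<close>). Everything else
  rests on one inequality (\<open>nonexpansive_functional_le\<close>): if \<open>\<phi>\<close> in the dual unit ball
  norms \<open>x - y\<close>, then \<open>\<phi> (f x - x) \<le> \<phi> (f y - y)\<close>. In particular an active
  functional only decreases on the displacement along the ray of \<open>x\<close>.

  If the displacement is onto, it takes the value \<open>- K x\<close> at some \<open>z\<close>. For large \<open>t\<close> a
  functional that norms \<open>t x - z\<close> is active at \<open>x\<close>, and the inequality bounds it by
  \<open>- K\<close> on the displacement at \<open>t x\<close>. A relative interior functional of the dual face
  gives each active functional a weight bounded below, so it tends to minus infinity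
  (\<open>displacement_tends_to_minus_infinity\<close>).

  For the converse, the limit condition speaks of one functional in each dual face. An
  induction on the number of active functionals improves it to a point at which all of them are as
  negative on the displacement as desired (\<open>common_descent_point\<close>); the key is that those
  which stay bounded below along a ray form the active set of another unit vector. Such points for all directions give a fixed
  point: the fixed points of the contractions \<open>r f\<close> cannot escape to infinity as
  \<open>r\<close> tends to \<open>1\<close>, since their displacement points outwards
  (\<open>fixed_point_if_descent\<close>). Subtracting a constant from \<open>f\<close> turns fixed points into
  arbitrary values of the displacement.
\<close>

section \<open>Coordinates and the Euclidean image of the unit ball\<close>

text \<open>The theorems of Minkowski and Weyl on polytopes concern the type class
  \<open>euclidean_space\<close>, whereas here finite dimension is a hypothesis about \<open>'a\<close>. The
  bridge is a type built from \<open>'a\<close> whose elements index a basis: real vectors over this index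
  type form a Euclidean space, into which \<open>'a\<close> embeds by its coordinates. The set below
  is a fixed finite basis, and empty if there is none, so that the index type is finite for every
  \<open>'a\<close>.\<close>

definition coord_basis :: "'a::real_vector itself \<Rightarrow> 'a set" where
  "coord_basis _ = (if \<exists>B::'a set. finite B \<and> independent B \<and> span B = UNIV
     then SOME B. finite B \<and> independent B \<and> span B = UNIV else {})"

lemma finite_coord_basis: "finite (coord_basis TYPE('a::real_vector))"
  unfolding coord_basis_def by (auto intro: someI2_ex)

lemma coord_basis:
  assumes "finite_dim_space TYPE('a::real_normed_vector)"
  shows "independent (coord_basis TYPE('a))" "span (coord_basis TYPE('a)) = UNIV"
proof -
  obtain B :: "'a set" where B: "finite B" "span B = UNIV"
    using assms by (auto simp: finite_dim_space_def)
  obtain B' where B': "B' \<subseteq> B" "independent B'" "B \<subseteq> span B'"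
    using maximal_independent_subset by blast
  have "finite B' \<and> independent B' \<and> span B' = UNIV"
    using B B' finite_subset span_minimal[OF B'(3)] by (metis subspace_span top.extremum_uniqueI)
  then have ex: "\<exists>B::'a set. finite B \<and> independent B \<and> span B = UNIV" by blast
  show "independent (coord_basis TYPE('a))" "span (coord_basis TYPE('a)) = UNIV"
    using someI_ex[OF ex] ex by (auto simp: coord_basis_def)
qed

text \<open>A type must be inhabited, but a basis may be empty. Adding the index \<open>0\<close> repairs this
  and costs a coordinate that vanishes on \<open>'a\<close>, because \<open>0\<close> is never a member of a basis.
  Hence \<open>coords\<close> below is an injection into a subspace, in general not onto.\<close>

typedef (overloaded) ('a::real_vector) coord_index = "insert 0 (coord_basis TYPE('a))"
  by blast

instance coord_index :: (real_vector) finite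
proof
  have "Abs_coord_index ` insert 0 (coord_basis TYPE('a)) = UNIV"
    by (rule type_definition.Abs_image[OF type_definition_coord_index])
  then show "finite (UNIV :: 'a coord_index set)"
    by (metis finite_coord_basis finite_imageI finite_insert)
qed

definition coords :: "'a::real_vector \<Rightarrow> real ^ 'a coord_index" where
  "coords x = (\<chi> i. representation (coord_basis TYPE('a)) x (Rep_coord_index i))"

definition from_coords :: "real ^ 'a::real_vector coord_index \<Rightarrow> 'a" where
  "from_coords y = (\<Sum>i\<in>UNIV. y $ i *\<^sub>R Rep_coord_index i)"

lemma linear_coords:
  assumes "finite_dim_space TYPE('a::real_normed_vector)"
  shows "linear (coords :: 'a \<Rightarrow> _)"
  using coord_basis[OF assms]
  by (intro linearI) (auto simp: coords_def vec_eq_iff real_vector.representation_add real_vector.representation_scale)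

lemma from_coords_coords:
  assumes "finite_dim_space TYPE('a::real_normed_vector)"
  shows "from_coords (coords x) = (x::'a)"
proof -
  let ?B = "coord_basis TYPE('a)"
  note B = coord_basis[OF assms] finite_coord_basis[where 'a='a]
  have bij: "bij_betw Rep_coord_index (UNIV :: 'a coord_index set) (insert 0 ?B)"
    by (metis type_definition.Rep_range type_definition_coord_index
        bij_betw_def Rep_coord_index_inject injI inj_on_subset subset_UNIV)
  have "from_coords (coords x) = (\<Sum>b\<in>insert 0 ?B. representation ?B x b *\<^sub>R b)"
    unfolding from_coords_def coords_def
    using sum.reindex_bij_betw[OF bij, of "\<lambda>b. representation ?B x b *\<^sub>R b"] by simp
  also have "\<dots> = (\<Sum>b\<in>?B. representation ?B x b *\<^sub>R b)"
    using B by (cases "0 \<in> ?B") (auto simp: insert_absorb)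
  also have "\<dots> = x"
    using B by (intro real_vector.sum_representation_eq) auto
  finally show ?thesis .
qed

lemma bounded_linear_from_coords:
  "bounded_linear (from_coords :: _ \<Rightarrow> 'a::real_normed_vector)"
proof -
  have "linear (from_coords :: _ \<Rightarrow> 'a)"
    by (intro linearI) (auto simp: from_coords_def scaleR_add_left sum.distrib scaleR_sum_right)
  then show ?thesis by (rule linear_conv_bounded_linear[THEN iffD1])
qed

text \<open>The reconstruction map does not vanish on the unit sphere of the coordinate subspace; this
  sphere is compact, so the map is bounded away from zero there, which bounds its inverse
  \<open>coords\<close>.\<close>

lemma bounded_linear_coords:
  assumes fd: "finite_dim_space TYPE('a::real_normed_vector)"
  shows "bounded_linear (coords :: 'a \<Rightarrow> _)"
proof -
  let ?J = "coords :: 'a \<Rightarrow> real ^ 'a coord_index"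
  let ?S = "range ?J \<inter> sphere 0 1"
  note lin = linear_coords[OF fd] and inv = from_coords_coords[OF fd]
  have "closed (range ?J)"
    by (intro closed_subspace linear_subspace_image[OF lin] subspace_UNIV)
  then have comp: "compact ?S" by (intro closed_Int_compact) auto
  show ?thesis
  proof (cases "?S = {}")
    case True
    \<comment> \<open>Here the coordinate subspace is zero.\<close>
    have "?J x = 0" for x
    proof (rule ccontr)
      assume n: "?J x \<noteq> 0"
      have "norm (?J (inverse (norm (?J x)) *\<^sub>R x)) = 1"
        using n by (simp add: linear_cmul[OF lin])
      then have "?J (inverse (norm (?J x)) *\<^sub>R x) \<in> ?S" by simp
      with True show False by blast
    qed
    then show ?thesis
      by (metis bounded_linear_zero ext)
  next
    case False
    have "continuous_on ?S (\<lambda>y. norm (from_coords y :: 'a))"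
      by (intro continuous_on_norm bounded_linear.continuous_on[OF bounded_linear_from_coords] continuous_on_id)
    then obtain y0 where y0: "y0 \<in> ?S" "\<And>y. y \<in> ?S \<Longrightarrow> norm (from_coords y0 :: 'a) \<le> norm (from_coords y :: 'a)"
      using continuous_attains_inf[OF comp False] by metis
    define m where "m = norm (from_coords y0 :: 'a)"
    obtain x0 where x0: "y0 = ?J x0" using y0 by blast
    have "x0 \<noteq> 0" using y0 x0 linear_0[OF lin] by auto
    then have "m > 0" by (simp add: m_def x0 inv)
    have "norm (?J x) \<le> norm x * (1/m)" for x
    proof (cases "?J x = 0")
      case n: False
      let ?y = "?J (inverse (norm (?J x)) *\<^sub>R x)"
      have "norm ?y = 1"
        using n by (simp add: linear_cmul[OF lin])
      then have "?y \<in> ?S" by simp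
      from y0(2)[OF this] have "m \<le> norm x / norm (?J x)"
        by (simp add: m_def inv field_simps)
      then show ?thesis using n \<open>m > 0\<close> by (simp add: field_simps)
    qed (use \<open>m > 0\<close> in auto)
    then show ?thesis
      using lin by (meson bounded_linear_intro linear_add linear_cmul)
  qed
qed

lemma compact_coords_cball:
  assumes fd: "finite_dim_space TYPE('a::real_normed_vector)"
  shows "compact (coords ` cball (0::'a) 1)"
proof -
  let ?J = "coords :: 'a \<Rightarrow> real ^ 'a coord_index"
  note lin = linear_coords[OF fd] and inv = from_coords_coords[OF fd]
  have "closed (range ?J)"
    by (intro closed_subspace linear_subspace_image[OF lin] subspace_UNIV)
  moreover have "closed ((from_coords :: _ \<Rightarrow> 'a) -` cball 0 1)"
    by (intro closed_vimage closed_cball bounded_linear.continuous_on[OF bounded_linear_from_coords] continuous_on_id)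
  moreover have "?J ` cball 0 1 = range ?J \<inter> from_coords -` cball 0 1"
    by (auto simp: inv)
  ultimately have "closed (?J ` cball 0 1)" by auto
  moreover have "bounded (?J ` cball 0 1)"
    by (intro bounded_linear_image bounded_linear_coords fd bounded_cball)
  ultimately show ?thesis by (simp add: compact_eq_bounded_closed)
qed

lemma compact_unit_ball:
  assumes fd: "finite_dim_space TYPE('a::real_normed_vector)"
  shows "compact (cball (0::'a) 1)"
proof -
  have "compact (from_coords ` (coords ` cball (0::'a) 1))"
    by (intro compact_continuous_image compact_coords_cball[OF fd]
        bounded_linear.continuous_on[OF bounded_linear_from_coords] continuous_on_id)
  then show ?thesis by (simp add: image_image from_coords_coords[OF fd])
qed

text \<open>A linear injection maps extreme points onto extreme points, and the compact convex image of
  the ball is the convex hull of its extreme points.\<close>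

lemma polytope_coords_cball:
  assumes fd: "finite_dim_space TYPE('a::real_normed_vector)"
    and "polyhedral_norm TYPE('a)"
  shows "polytope (coords ` cball (0::'a) 1)"
proof -
  let ?J = "coords :: 'a \<Rightarrow> real ^ 'a coord_index"
  let ?S = "?J ` cball 0 1"
  note lin = linear_coords[OF fd]
  have inj: "inj ?J" by (metis from_coords_coords[OF fd] injI)
  have "{y. y extreme_point_of ?S} \<subseteq> ?J ` {x. x extreme_point_of cball 0 1}"
  proof
    fix y assume "y \<in> {y. y extreme_point_of ?S}"
    then have y: "y extreme_point_of ?S" by simp
    then obtain x where x: "y = ?J x" "x \<in> cball 0 1" by (auto simp: extreme_point_of_def)
    have "x \<notin> open_segment a b" if "a \<in> cball 0 1" "b \<in> cball 0 1" for a b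
    proof
      assume "x \<in> open_segment a b"
      then have "?J x \<in> open_segment (?J a) (?J b)"
        by (metis open_segment_linear_image[OF lin inj] imageI)
      then show False using y that by (auto simp: extreme_point_of_def x)
    qed
    with x show "y \<in> ?J ` {x. x extreme_point_of cball 0 1}" by (auto simp: extreme_point_of_def)
  qed
  then have "finite {y. y extreme_point_of ?S}"
    using assms(2) finite_surj by (auto simp: polyhedral_norm_def)
  moreover have "?S = convex hull {y. y extreme_point_of ?S}"
    by (intro Krein_Milman_Minkowski compact_coords_cball[OF fd] convex_linear_image[OF lin] convex_cball)
  ultimately show ?thesis by (auto simp: polytope_def)
qed

section \<open>Finitely many norming functionals\<close>

lemma functional_le:
  assumes "norm (\<psi> :: 'a::real_normed_vector \<Rightarrow>\<^sub>L real) \<le> 1"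
  shows "blinfun_apply \<psi> x \<le> norm x"
  by (smt (verit) assms norm_blinfun mult_left_le_one_le norm_ge_zero real_norm_def)

text \<open>A norming set plays the part of the extreme points of the dual ball: the norm is the maximum
  of finitely many functionals in the dual unit ball. No functional attains the norm of \<open>0\<close> if the set is empty,
  so only nonzero vectors are considered; this admits the empty set for the zero space.\<close>

definition norming :: "('a::real_normed_vector \<Rightarrow>\<^sub>L real) set \<Rightarrow> bool" where
  "norming E \<longleftrightarrow> finite E \<and> (\<forall>\<phi>\<in>E. norm \<phi> \<le> 1) \<and>
     (\<forall>x. x \<noteq> 0 \<longrightarrow> (\<exists>\<phi>\<in>E. blinfun_apply \<phi> x = norm x))"

lemma norming_le: "norming E \<Longrightarrow> \<phi> \<in> E \<Longrightarrow> blinfun_apply \<phi> x \<le> norm x"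
  by (simp add: norming_def functional_le)

text \<open>A polytope is an intersection of finitely many half-spaces. After normalisation the
  half-spaces that describe the unit ball have the form \<open>\<phi> x \<le> 1\<close>, and these functionals
  norm the space. A half-space whose boundary passes through the origin restricts nothing: the
  ball is a neighbourhood of the origin, so its functional vanishes on the whole space.\<close>

lemma norming_exists:
  assumes fd: "finite_dim_space TYPE('a::real_normed_vector)"
    and poly: "polyhedral_norm TYPE('a)"
  obtains E :: "('a::real_normed_vector \<Rightarrow>\<^sub>L real) set" where "norming E"
proof -
  let ?J = "coords :: 'a \<Rightarrow> real ^ 'a coord_index"
  let ?S = "?J ` cball 0 1"
  note lin = linear_coords[OF fd]
  have inj: "inj ?J" by (metis from_coords_coords[OF fd] injI)
  have "polyhedron ?S"
    by (intro polytope_imp_polyhedron polytope_coords_cball assms)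
  then obtain H where H: "finite H" "?S = \<Inter>H" "\<forall>h\<in>H. \<exists>a b. h = {y. a \<bullet> y \<le> b}"
    by (auto simp: polyhedron_def) metis
  then obtain a b where ab: "\<And>h. h \<in> H \<Longrightarrow> h = {y. a h \<bullet> y \<le> b h}" by metis
  have ball_iff: "norm x \<le> 1 \<longleftrightarrow> (\<forall>h\<in>H. a h \<bullet> ?J x \<le> b h)" for x
  proof -
    have "norm x \<le> 1 \<longleftrightarrow> ?J x \<in> ?S" using inj by (auto simp: inj_image_mem_iff)
    also have "\<dots> \<longleftrightarrow> (\<forall>h\<in>H. a h \<bullet> ?J x \<le> b h)" unfolding H(2) using ab by blast
    finally show ?thesis .
  qed
  have b0: "0 \<le> b h" if "h \<in> H" for h
    using ball_iff[of 0] that by (simp add: linear_0[OF lin])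
  have blin: "bounded_linear (\<lambda>x. (a h \<bullet> ?J x) / b h)" for h
    by (intro bounded_linear_compose[OF bounded_linear_divide]
        bounded_linear_compose[OF bounded_linear_inner_right] bounded_linear_coords[OF fd])
  define \<phi> where "\<phi> h = Blinfun (\<lambda>x. (a h \<bullet> ?J x) / b h)" for h
  have \<phi>: "blinfun_apply (\<phi> h) x = (a h \<bullet> ?J x) / b h" for h x
    unfolding \<phi>_def using blin by (simp add: bounded_linear_Blinfun_apply)
  define E where "E = \<phi> ` {h\<in>H. b h > 0}"
  have le1: "blinfun_apply \<psi> x \<le> 1" if "\<psi> \<in> E" "norm x \<le> 1" for \<psi> x
    using that ball_iff[of x] by (auto simp: E_def \<phi> divide_le_eq)
  have norm_E: "norm \<psi> \<le> 1" if "\<psi> \<in> E" for \<psi>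
  proof (rule norm_blinfun_bound)
    fix x
    show "norm (blinfun_apply \<psi> x) \<le> 1 * norm x"
    proof (cases "x = 0")
      case False
      have "blinfun_apply \<psi> (x /\<^sub>R norm x) \<le> 1" "blinfun_apply \<psi> (- (x /\<^sub>R norm x)) \<le> 1"
        using False by (auto intro!: le1[OF that])
      then show ?thesis using False
        by (auto simp: blinfun.scaleR_right blinfun.minus_right field_simps abs_le_iff)
    qed auto
  qed auto
  have attain: "\<exists>\<psi>\<in>E. blinfun_apply \<psi> x = norm x" if "x \<noteq> 0" for x
  proof (rule ccontr)
    assume "\<not> ?thesis"
    moreover have "blinfun_apply \<psi> x \<le> norm x" if "\<psi> \<in> E" for \<psi>
      using functional_le[OF norm_E[OF that]] .
    ultimately have lt: "blinfun_apply \<psi> x < norm x" if "\<psi> \<in> E" for \<psi>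
      using that by (metis less_eq_real_def)
    \<comment> \<open>Dividing by \<open>m\<close> gives a vector outside the unit ball that satisfies all its inequalities;
      the term \<open>norm x / 2\<close> keeps \<open>m\<close> positive.\<close>
    define m where "m = Max (insert (norm x / 2) ((\<lambda>\<psi>. blinfun_apply \<psi> x) ` E))"
    have fin: "finite E" using H by (simp add: E_def)
    have "m < norm x" using fin lt that by (simp add: m_def)
    moreover have "norm x / 2 \<le> m" unfolding m_def by (rule Max_ge) (use fin in auto)
    moreover have "blinfun_apply \<psi> x \<le> m" if "\<psi> \<in> E" for \<psi>
      unfolding m_def by (rule Max_ge) (use fin that in auto)
    ultimately have m: "m < norm x" "norm x / 2 \<le> m"
      "\<And>\<psi>. \<psi> \<in> E \<Longrightarrow> blinfun_apply \<psi> x \<le> m" by blast+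
    have "m > 0" using m(2) that by (smt (verit) half_gt_zero zero_less_norm_iff)
    have "a h \<bullet> ?J (x /\<^sub>R m) \<le> b h" if h: "h \<in> H" for h
    proof (cases "b h > 0")
      case True
      then have "\<phi> h \<in> E" using h by (auto simp: E_def)
      from m(3)[OF this] show ?thesis using True \<open>m > 0\<close>
        by (simp add: \<phi> linear_cmul[OF lin] field_simps)
    next
      case False
      then have "b h = 0" using b0[OF h] by simp
      moreover have "norm (x /\<^sub>R norm x) \<le> 1" using \<open>x \<noteq> 0\<close> by simp
      ultimately have "a h \<bullet> ?J (x /\<^sub>R norm x) \<le> 0" using ball_iff h by metis
      then have "a h \<bullet> ?J x \<le> 0" using \<open>x \<noteq> 0\<close> by (simp add: linear_cmul[OF lin] field_simps mult_le_0_iff)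
      then show ?thesis using \<open>b h = 0\<close> \<open>m > 0\<close> by (simp add: linear_cmul[OF lin] field_simps mult_le_0_iff)
    qed
    then have "norm (x /\<^sub>R m) \<le> 1" using ball_iff by blast
    then show False using \<open>m > 0\<close> m(1) by (simp add: field_simps)
  qed
  have "norming E"
    using norm_E attain H(1) by (auto simp: norming_def E_def)
  then show ?thesis using that by blast
qed

section \<open>Active functionals\<close>

text \<open>For nonzero \<open>x\<close> these are, up to scaling by \<open>norm x\<close>, the members of \<open>E\<close> in
  the dual face \<open>duality_map x\<close>. They stand for its vertices, and a face of the ball is
  handled through the active set common to its relative interior points.\<close>

definition active :: "('a::real_normed_vector \<Rightarrow>\<^sub>L real) set \<Rightarrow> 'a \<Rightarrow> ('a \<Rightarrow>\<^sub>L real) set" where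
  "active E x = {\<phi> \<in> E. blinfun_apply \<phi> x = norm x}"

lemma active_nonempty: "norming E \<Longrightarrow> x \<noteq> 0 \<Longrightarrow> active E x \<noteq> {}"
  by (auto simp: norming_def active_def)

lemma finite_active: "norming E \<Longrightarrow> finite (active E x)"
  by (auto simp: norming_def active_def)

lemma active_scaleR: "c > 0 \<Longrightarrow> active E (c *\<^sub>R x) = active E x"
  by (auto simp: active_def blinfun.scaleR_right)

text \<open>Finiteness of \<open>E\<close> enters here: the finitely many functionals that are not active at the
  limit miss the norm by a positive amount, and still do so nearby. For a smooth norm,
  where the dual sphere takes the place of \<open>E\<close>, this inclusion fails.\<close>

lemma eventually_active_subset:
  assumes E: "norming E" and lim: "(z \<longlongrightarrow> y) F"
  shows "\<forall>\<^sub>F n in F. active E (z n) \<subseteq> active E y"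
proof -
  have "\<forall>\<^sub>F n in F. blinfun_apply \<phi> (z n) < norm (z n)" if "\<phi> \<in> E - active E y" for \<phi>
  proof -
    have "blinfun_apply \<phi> y < norm y"
      using that norming_le[OF E, of \<phi> y] by (auto simp: active_def)
    then have "0 < norm y - blinfun_apply \<phi> y" by simp
    moreover have "((\<lambda>n. norm (z n) - blinfun_apply \<phi> (z n)) \<longlongrightarrow> norm y - blinfun_apply \<phi> y) F"
      by (intro tendsto_intros lim)
    ultimately have "\<forall>\<^sub>F n in F. 0 < norm (z n) - blinfun_apply \<phi> (z n)"
      by (rule order_tendstoD(1)[rotated])
    then show ?thesis by simp
  qed
  moreover have "finite (E - active E y)" using E by (auto simp: norming_def)
  ultimately have "\<forall>\<^sub>F n in F. \<forall>\<phi>\<in>E - active E y. blinfun_apply \<phi> (z n) < norm (z n)"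
    by (simp add: eventually_ball_finite)
  then show ?thesis
    by eventually_elim (force simp: active_def)
qed

text \<open>A dual unit vector that norms \<open>x\<close> cannot be smaller than every active functional on
  \<open>w\<close>. This is what remains of the fact that the dual face is the convex hull of the active
  functionals, and it follows without convexity from the norm at \<open>x - s w\<close> for small
  \<open>s > 0\<close>, where an active functional is also active at \<open>x\<close>.\<close>

lemma active_functional_below:
  assumes E: "norming E" and x: "norm x = 1" and \<psi>: "norm \<psi> \<le> 1" "blinfun_apply \<psi> x = 1"
  obtains \<phi> where "\<phi> \<in> active E x" "blinfun_apply \<phi> w \<le> blinfun_apply \<psi> w"
proof -
  have lim: "((\<lambda>s. x - s *\<^sub>R w) \<longlongrightarrow> x) (at_right 0)"
    by (rule tendsto_eq_intros refl tendsto_ident_at | simp)+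
  have "\<forall>\<^sub>F s in at_right 0. (x - s *\<^sub>R w) \<noteq> 0"
    using lim x by (intro tendsto_imp_eventually_ne) auto
  moreover have "\<forall>\<^sub>F s in at_right (0::real). 0 < s" by (rule eventually_at_right_less)
  ultimately have "\<forall>\<^sub>F s in at_right 0. 0 < s \<and> (x - s *\<^sub>R w) \<noteq> 0 \<and> active E (x - s *\<^sub>R w) \<subseteq> active E x"
    using eventually_active_subset[OF E lim] by eventually_elim auto
  then obtain s where s: "0 < s" "x - s *\<^sub>R w \<noteq> 0" "active E (x - s *\<^sub>R w) \<subseteq> active E x"
    using eventually_happens'[OF trivial_limit_at_right_real] by blast
  obtain \<phi> where \<phi>: "\<phi> \<in> active E (x - s *\<^sub>R w)" using active_nonempty[OF E s(2)] by blast
  have "blinfun_apply \<psi> (x - s *\<^sub>R w) \<le> norm (x - s *\<^sub>R w)" using functional_le[OF \<psi>(1)] .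
  also have "\<dots> = blinfun_apply \<phi> (x - s *\<^sub>R w)" using \<phi> by (simp add: active_def)
  finally have "1 - s * blinfun_apply \<psi> w \<le> 1 - s * blinfun_apply \<phi> w"
    using \<phi> s(3) x \<psi>(2) by (auto simp: active_def blinfun.diff_right blinfun.scaleR_right)
  then have "blinfun_apply \<phi> w \<le> blinfun_apply \<psi> w" using s(1) by simp
  with \<phi> s(3) that show ?thesis by blast
qed

section \<open>Faces, dual faces and relative interiors\<close>

text \<open>The step length is uniform over all points within distance \<open>r\<close>. Applied to a dual
  face, this says that a relative interior functional gives every member of the face a weight
  that is bounded away from zero.\<close>

lemma rel_interior_extend:
  fixes S :: "'a::real_normed_vector set"
  assumes "x \<in> rel_interior S" "r > 0"
  obtains e where "e > 0" "\<And>y. y \<in> S \<Longrightarrow> norm (x - y) \<le> r \<Longrightarrow> x + e *\<^sub>R (x - y) \<in> S"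
proof -
  obtain d where d: "d > 0" "ball x d \<inter> affine hull S \<subseteq> S" and x: "x \<in> S"
    using assms by (auto simp: mem_rel_interior_ball)
  show ?thesis
  proof
    show "d / (2 * r) > 0" using d assms by simp
    fix y assume y: "y \<in> S" "norm (x - y) \<le> r"
    let ?e = "d / (2 * r)"
    have "norm (?e *\<^sub>R (x - y)) \<le> ?e * r"
      using mult_left_mono[OF y(2), of ?e] d assms by simp
    also have "\<dots> < d" using d assms by simp
    finally have "x + ?e *\<^sub>R (x - y) \<in> ball x d" by (simp add: dist_norm)
    moreover have "(1 + ?e) *\<^sub>R x + (- ?e) *\<^sub>R y \<in> affine hull S"
      using x y by (intro mem_affine affine_affine_hull hull_inc) auto
    then have "x + ?e *\<^sub>R (x - y) \<in> affine hull S" by (simp add: algebra_simps)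
    ultimately show "x + ?e *\<^sub>R (x - y) \<in> S" using d by blast
  qed
qed

text \<open>The segment from \<open>y\<close> to \<open>x\<close> can be prolonged within \<open>S\<close>, where the functional
  would exceed its maximum if it were smaller at \<open>y\<close>.\<close>

lemma functional_constant_if_max_at_rel_interior:
  fixes \<phi> :: "'a::real_normed_vector \<Rightarrow>\<^sub>L real"
  assumes x: "x \<in> rel_interior S" and y: "y \<in> S"
    and max: "\<And>z. z \<in> S \<Longrightarrow> blinfun_apply \<phi> z \<le> blinfun_apply \<phi> x"
  shows "blinfun_apply \<phi> y = blinfun_apply \<phi> x"
proof -
  obtain e where e: "e > 0" "x + e *\<^sub>R (x - y) \<in> S"
    using rel_interior_extend[OF x, of "norm (x - y) + 1"] y
    by (metis add_nonneg_pos less_add_one less_eq_real_def norm_ge_zero zero_less_one)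
  from max[OF e(2)] have "e * (blinfun_apply \<phi> x - blinfun_apply \<phi> y) \<le> 0"
    by (simp add: blinfun.add_right blinfun.scaleR_right blinfun.diff_right)
  with e(1) max[OF y] show ?thesis by (smt (verit) mult_pos_pos)
qed

text \<open>Every other point of the ball is an endpoint of an open segment in the ball through a given
  interior point, so a face that contains an interior point is the whole ball.\<close>

lemma norm_proper_face:
  fixes F :: "'a::real_normed_vector set"
  assumes F: "F \<in> proper_faces" and x: "x \<in> F"
  shows "norm x = 1"
proof (rule ccontr)
  assume "norm x \<noteq> 1"
  have face: "F face_of cball 0 1" and neq: "F \<noteq> cball 0 1" using F by (auto simp: proper_faces_def)
  have "norm x \<le> 1" using face x face_of_imp_subset by fastforce
  with \<open>norm x \<noteq> 1\<close> have lt: "norm x < 1" by simp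
  have "y \<in> F" if y: "y \<in> cball 0 1" for y
  proof (cases "y = x")
    case False
    define e where "e = (1 - norm x) / 2"
    have e: "e > 0" using lt by (simp add: e_def)
    let ?z = "x + e *\<^sub>R (x - y)"
    have "norm ?z \<le> norm x + e * (norm x + norm y)"
      using e by (smt (verit) norm_triangle_ineq norm_triangle_ineq4 norm_scaleR mult_left_mono)
    also have "\<dots> \<le> norm x + e * 2"
      using e y lt by (intro add_left_mono mult_left_mono) auto
    also have "\<dots> = 1" by (simp add: e_def field_simps)
    finally have z: "?z \<in> cball 0 1" by simp
    have zy: "?z - y = (1 + e) *\<^sub>R (x - y)" by (simp add: algebra_simps)
    have "(1 - (1 - 1 / (1 + e))) *\<^sub>R ?z + (1 - 1 / (1 + e)) *\<^sub>R y = y + (1 / (1 + e)) *\<^sub>R (?z - y)"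
      by (simp add: scaleR_diff_right scaleR_diff_left)
    also have "\<dots> = x" unfolding zy using e by simp
    finally have "x = (1 - (1 - 1 / (1 + e))) *\<^sub>R ?z + (1 - 1 / (1 + e)) *\<^sub>R y" ..
    moreover have "0 < 1 - 1 / (1 + e)" "1 - 1 / (1 + e) < 1" using e by auto
    moreover have "?z \<noteq> y"
    proof
      assume "?z = y"
      then have "(1 + e) *\<^sub>R (x - y) = 0" using zy by simp
      then show False using e False by auto
    qed
    ultimately have "x \<in> open_segment ?z y" unfolding in_segment by blast
    with face_ofD[OF face this z y x] show ?thesis by blast
  qed (use x in simp)
  then have "F = cball 0 1" using face face_of_imp_subset by blast
  with neq show False by blast
qed

text \<open>The union in the dual face is constant: a dual vector that norms one relative interior point
  of \<open>F\<close> is maximal there, hence norms all of \<open>F\<close>.\<close>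

lemma dual_face_eq_duality_map:
  fixes F :: "'a::real_normed_vector set"
  assumes F: "F \<in> proper_faces" and x: "x \<in> rel_interior F"
  shows "dual_face F = duality_map x"
proof -
  have "duality_map y \<subseteq> duality_map x" if y: "y \<in> rel_interior F" for y
  proof
    fix \<phi> assume \<phi>: "\<phi> \<in> duality_map y"
    have yF: "y \<in> F" and xF: "x \<in> F" using x y rel_interior_subset by blast+
    have nF: "\<And>z. z \<in> F \<Longrightarrow> norm z = 1" using norm_proper_face[OF F] .
    have \<phi>1: "norm \<phi> = 1" "blinfun_apply \<phi> y = 1"
      using \<phi> nF[OF yF] by (auto simp: duality_map_def)
    have "blinfun_apply \<phi> z \<le> blinfun_apply \<phi> y" if "z \<in> F" for z
      using functional_le[of \<phi> z] \<phi>1 nF[OF that] by simp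
    from functional_constant_if_max_at_rel_interior[OF y xF this]
    show "\<phi> \<in> duality_map x" using \<phi>1 nF[OF xF] by (simp add: duality_map_def)
  qed
  with x show ?thesis by (auto simp: dual_face_def)
qed

text \<open>Every unit vector \<open>x\<close> lies in a proper face all of whose relative interior points share
  the active functionals of \<open>x\<close>. A condition on one chosen point in each proper face
  therefore reaches the active set of every unit vector.\<close>

lemma face_with_given_active_set:
  assumes E: "norming E" and x: "norm x = 1"
  defines "F \<equiv> {z \<in> cball 0 1. \<forall>\<phi>\<in>active E x. blinfun_apply \<phi> z = 1}"
  shows "F \<in> proper_faces" "y \<in> rel_interior F \<Longrightarrow> active E y = active E x"
proof -
  have x0: "x \<noteq> 0" using x by auto
  have le1: "blinfun_apply \<phi> z \<le> 1" if "\<phi> \<in> active E x" "z \<in> cball 0 1" for \<phi> z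
    using that norming_le[OF E, of \<phi> z] by (auto simp: active_def)
  have xF: "x \<in> F" using x by (auto simp: F_def active_def)
  have "F = cball 0 1 \<inter> (\<Inter>\<phi>\<in>active E x. blinfun_apply \<phi> -` {1})" by (auto simp: F_def)
  moreover have "convex (blinfun_apply \<phi> -` {1})" for \<phi> :: "'a \<Rightarrow>\<^sub>L real"
    by (intro convex_linear_vimage bounded_linear.linear blinfun.bounded_linear_right convex_singleton)
  ultimately have "convex F" by (simp add: convex_Int convex_INT)
  moreover have "a \<in> F \<and> b \<in> F"
    if ab: "a \<in> cball 0 1" "b \<in> cball 0 1" and z: "z \<in> F" "z \<in> open_segment a b" for a b z
  proof -
    obtain u where u: "0 < u" "u < 1" "z = (1 - u) *\<^sub>R a + u *\<^sub>R b" using z(2) by (auto simp: in_segment)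
    have "blinfun_apply \<phi> a = 1 \<and> blinfun_apply \<phi> b = 1" if "\<phi> \<in> active E x" for \<phi>
    proof -
      have "(1 - u) * blinfun_apply \<phi> a + u * blinfun_apply \<phi> b = 1"
        using z(1) that by (simp add: F_def u(3) blinfun.add_right blinfun.scaleR_right)
      then have "(1 - u) * (1 - blinfun_apply \<phi> a) + u * (1 - blinfun_apply \<phi> b) = 0"
        by (simp add: algebra_simps)
      moreover have "(1 - u) * (1 - blinfun_apply \<phi> a) \<ge> 0" "u * (1 - blinfun_apply \<phi> b) \<ge> 0"
        using u le1[OF that] ab by auto
      ultimately have "(1 - u) * (1 - blinfun_apply \<phi> a) = 0 \<and> u * (1 - blinfun_apply \<phi> b) = 0" by linarith
      then show ?thesis using u by (simp add: mult_eq_0_iff)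
    qed
    then show ?thesis using ab unfolding F_def by blast
  qed
  moreover have "F \<subseteq> cball 0 1" by (auto simp: F_def)
  ultimately have "F face_of cball 0 1" unfolding face_of_def by blast
  moreover have "0 \<notin> F" using active_nonempty[OF E x0] by (auto simp: F_def)
  then have "F \<noteq> cball 0 1" by auto
  ultimately show F: "F \<in> proper_faces" using xF by (auto simp: proper_faces_def)
  assume y: "y \<in> rel_interior F"
  then have yF: "y \<in> F" using rel_interior_subset by blast
  have ny: "norm y = 1" using norm_proper_face[OF F yF] .
  have "blinfun_apply \<phi> x = 1" if "\<phi> \<in> active E y" for \<phi>
  proof -
    have \<phi>: "\<phi> \<in> E" "blinfun_apply \<phi> y = 1" using that ny by (auto simp: active_def)
    have "blinfun_apply \<phi> z \<le> blinfun_apply \<phi> y" if "z \<in> F" for z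
      using norming_le[OF E \<phi>(1), of z] \<phi>(2) that by (auto simp: F_def)
    from functional_constant_if_max_at_rel_interior[OF y xF this] \<phi> show ?thesis by simp
  qed
  then show "active E y = active E x" using yF ny x by (auto simp: active_def F_def)
qed

section \<open>The displacement of a nonexpansive map\<close>

text \<open>The inequality behind both directions: if \<open>\<phi>\<close> norms \<open>x - y\<close>, then \<open>f\<close> cannot
  increase the \<open>\<phi>\<close>-distance of \<open>x\<close> from \<open>y\<close>, so the displacement seen by
  \<open>\<phi>\<close> decreases from \<open>y\<close> to \<open>x\<close>.\<close>

lemma nonexpansive_functional_le:
  assumes f: "nonexpansive f" and \<phi>: "norm \<phi> \<le> 1" "blinfun_apply \<phi> (x - y) = norm (x - y)"
  shows "blinfun_apply \<phi> (f x - x) \<le> blinfun_apply \<phi> (f y - y)"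
proof -
  have "blinfun_apply \<phi> (f x - f y) \<le> norm (x - y)"
    using functional_le[OF \<phi>(1), of "f x - f y"] f
    unfolding nonexpansive_def by (meson order_trans)
  with \<phi>(2) show ?thesis by (simp add: blinfun.diff_right)
qed

lemma displacement_along_active:
  fixes f :: "'a::real_normed_vector \<Rightarrow> 'a"
  assumes f: "nonexpansive f" and E: "norming E"
    and \<phi>: "\<phi> \<in> active E x" and t: "t \<ge> 0"
  shows "blinfun_apply \<phi> (f (w + t *\<^sub>R x) - (w + t *\<^sub>R x)) \<le> blinfun_apply \<phi> (f w - w)"
  using \<phi> t E
  by (intro nonexpansive_functional_le[OF f]) (auto simp: active_def norming_def blinfun.scaleR_right)

text \<open>Let \<open>f z - z = - K x\<close>. For large \<open>t\<close>, a functional active at \<open>t x - z\<close> is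
  active at \<open>x\<close>, so by comparison with \<open>z\<close> some active functional, which may depend on \<open>t\<close>, is at
  most \<open>- K\<close> on the displacement at \<open>t x\<close>. As \<open>\<psi>\<close> is a relative interior point,
  it gives this functional a weight bounded below, and the rest of the dual face contributes at
  most \<open>norm (f 0)\<close>.\<close>

lemma displacement_tends_to_minus_infinity:
  fixes f :: "'a::real_normed_vector \<Rightarrow> 'a" and E :: "('a \<Rightarrow>\<^sub>L real) set"
  assumes E: "norming E" and f: "nonexpansive f" and surj: "surj (\<lambda>x. f x - x)"
    and x: "norm x = 1" and \<psi>: "\<psi> \<in> rel_interior (duality_map x)"
  shows "filterlim (\<lambda>t::real. blinfun_apply \<psi> (f (t *\<^sub>R x) - t *\<^sub>R x)) at_bot at_top"
proof -
  define d where "d t = f (t *\<^sub>R x) - t *\<^sub>R x" for t :: real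
  obtain e where e: "e > 0"
    "\<And>\<phi>. \<phi> \<in> duality_map x \<Longrightarrow> norm (\<psi> - \<phi>) \<le> 2 \<Longrightarrow> \<psi> + e *\<^sub>R (\<psi> - \<phi>) \<in> duality_map x"
    using rel_interior_extend[OF \<psi>, of 2] by (metis zero_less_numeral)
  have \<psi>1: "norm \<psi> = 1" using \<psi> x rel_interior_subset by (fastforce simp: duality_map_def)
  have split: "(1 + e) * blinfun_apply \<psi> (d t) \<le> norm (f 0) + e * blinfun_apply \<phi> (d t)"
    if \<phi>: "\<phi> \<in> active E x" and t: "t \<ge> 0" for \<phi> t
  proof -
    have \<phi>x: "norm \<phi> \<le> 1" "blinfun_apply \<phi> x = 1"
      using \<phi> E x by (auto simp: active_def norming_def)
    moreover have "1 \<le> norm \<phi>"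
      using norm_blinfun[of \<phi> x] \<phi>x x by simp
    ultimately have \<phi>J: "\<phi> \<in> duality_map x" using x by (simp add: duality_map_def)
    have "norm (\<psi> - \<phi>) \<le> 2" using norm_triangle_ineq4[of \<psi> \<phi>] \<psi>1 \<phi>x by simp
    \<comment> \<open>\<open>\<psi>\<close> is the convex combination of \<open>\<eta>\<close> and \<open>\<phi>\<close> with weights proportional to \<open>1\<close> and \<open>e\<close>.\<close>
    define \<eta> where "\<eta> = \<psi> + e *\<^sub>R (\<psi> - \<phi>)"
    have "\<eta> \<in> duality_map x" using e(2)[OF \<phi>J \<open>norm (\<psi> - \<phi>) \<le> 2\<close>] by (simp add: \<eta>_def)
    then have \<eta>: "norm \<eta> \<le> 1" "blinfun_apply \<eta> x = 1" using x by (auto simp: duality_map_def)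
    have "blinfun_apply \<eta> (d t) \<le> blinfun_apply \<eta> (f 0 - 0)"
      unfolding d_def using \<eta> t x by (intro nonexpansive_functional_le[OF f]) (auto simp: blinfun.scaleR_right)
    also have "\<dots> \<le> norm (f 0)" using functional_le[OF \<eta>(1)] by simp
    finally have "blinfun_apply \<eta> (d t) \<le> norm (f 0)" .
    moreover have "blinfun_apply \<eta> (d t) = (1 + e) * blinfun_apply \<psi> (d t) - e * blinfun_apply \<phi> (d t)"
      unfolding \<eta>_def blinfun.add_left blinfun.scaleR_left blinfun.diff_left real_scaleR_def by algebra
    ultimately show ?thesis by linarith
  qed
  have "\<forall>\<^sub>F t in at_top. blinfun_apply \<psi> (d t) \<le> Z" for Z
  proof -
    \<comment> \<open>With this \<open>K\<close> the upper bound for \<open>(1 + e) * \<psi> (d t)\<close> becomes \<open>(1 + e) * Z\<close>.\<close>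
    define K where "K = (norm (f 0) - (1 + e) * Z) / e"
    obtain z where "- K *\<^sub>R x = f z - z" using surjD[OF surj, of "- K *\<^sub>R x"] by blast
    then have z: "f z - z = - K *\<^sub>R x" ..
    have lim: "((\<lambda>t. x - (1 / t) *\<^sub>R z) \<longlongrightarrow> x) at_top"
      by (rule tendsto_eq_intros refl tendsto_divide_0 filterlim_at_top_imp_at_infinity filterlim_ident | simp)+
    have "\<forall>\<^sub>F t in at_top. x - (1 / t) *\<^sub>R z \<noteq> 0"
      using lim x by (intro tendsto_imp_eventually_ne) auto
    moreover have "\<forall>\<^sub>F t in at_top. (t::real) > 0" by (rule eventually_gt_at_top)
    moreover note eventually_active_subset[OF E lim]
    ultimately show ?thesis
    proof eventually_elim
      case (elim t)
      have eq: "t *\<^sub>R x - z = t *\<^sub>R (x - (1 / t) *\<^sub>R z)" using elim by (simp add: algebra_simps)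
      obtain \<phi> where \<phi>: "\<phi> \<in> active E (x - (1 / t) *\<^sub>R z)"
        using active_nonempty[OF E elim(1)] by blast
      then have \<phi>z: "\<phi> \<in> active E (t *\<^sub>R x - z)" using elim by (simp add: eq active_scaleR)
      have \<phi>x: "\<phi> \<in> active E x" using \<phi> elim by blast
      have "blinfun_apply \<phi> (d t) \<le> blinfun_apply \<phi> (f z - z)"
        unfolding d_def using \<phi>z E by (intro nonexpansive_functional_le[OF f]) (auto simp: active_def norming_def)
      also have "\<dots> = - K" using \<phi>x x by (simp add: z active_def blinfun.scaleR_right blinfun.minus_right)
      finally have "e * blinfun_apply \<phi> (d t) \<le> e * - K" using e by (intro mult_left_mono) auto
      moreover have "e * - K = (1 + e) * Z - norm (f 0)" using e by (simp add: K_def field_simps)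
      ultimately have "(1 + e) * blinfun_apply \<psi> (d t) \<le> (1 + e) * Z"
        using split[OF \<phi>x, of t] elim by simp
      then show ?case using e by simp
    qed
  qed
  then show ?thesis by (simp add: filterlim_at_bot d_def)
qed

text \<open>The values of finitely many functionals at \<open>w\<close> are also attained at a vector \<open>c\<close>
  whose norm is controlled by these values alone. The induction adds one functional \<open>\<psi>\<close>:
  either it vanishes on the common kernel of the others, and then the same \<open>c\<close> serves, or \<open>c\<close>
  is corrected along a vector of that kernel.\<close>

lemma bounded_lift:
  fixes G :: "('a::real_normed_vector \<Rightarrow>\<^sub>L real) set"
  assumes "finite G"
  shows "\<exists>K\<ge>0. \<forall>w. \<exists>c. (\<forall>\<phi>\<in>G. blinfun_apply \<phi> c = blinfun_apply \<phi> w) \<and>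
      norm c \<le> K * (\<Sum>\<phi>\<in>G. \<bar>blinfun_apply \<phi> w\<bar>)"
  using assms
proof induction
  case empty
  show ?case by (auto intro!: exI[of _ 0])
next
  case (insert \<psi> G)
  then obtain K where K: "K \<ge> 0"
    "\<And>w. \<exists>c. (\<forall>\<phi>\<in>G. blinfun_apply \<phi> c = blinfun_apply \<phi> w) \<and>
      norm c \<le> K * (\<Sum>\<phi>\<in>G. \<bar>blinfun_apply \<phi> w\<bar>)" by metis
  show ?case
  proof (cases "\<exists>e. (\<forall>\<phi>\<in>G. blinfun_apply \<phi> e = 0) \<and> blinfun_apply \<psi> e \<noteq> 0")
    case False
    show ?thesis
    proof (intro exI[of _ K] conjI allI K)
      fix w
      obtain c where c: "\<forall>\<phi>\<in>G. blinfun_apply \<phi> c = blinfun_apply \<phi> w"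
        "norm c \<le> K * (\<Sum>\<phi>\<in>G. \<bar>blinfun_apply \<phi> w\<bar>)" using K by metis
      then have "blinfun_apply \<psi> (c - w) = 0"
        using False by (metis blinfun.diff_right right_minus_eq)
      moreover have "K * (\<Sum>\<phi>\<in>G. \<bar>blinfun_apply \<phi> w\<bar>) \<le> K * (\<Sum>\<phi>\<in>insert \<psi> G. \<bar>blinfun_apply \<phi> w\<bar>)"
        using insert K by (intro mult_left_mono) auto
      ultimately show "\<exists>c. (\<forall>\<phi>\<in>insert \<psi> G. blinfun_apply \<phi> c = blinfun_apply \<phi> w) \<and>
          norm c \<le> K * (\<Sum>\<phi>\<in>insert \<psi> G. \<bar>blinfun_apply \<phi> w\<bar>)"
        using c by (intro exI[of _ c]) (auto simp: blinfun.diff_right)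
    qed
  next
    case True
    then obtain e0 where e0: "\<forall>\<phi>\<in>G. blinfun_apply \<phi> e0 = 0" "blinfun_apply \<psi> e0 \<noteq> 0" by blast
    define e where "e = e0 /\<^sub>R blinfun_apply \<psi> e0"
    have e: "\<forall>\<phi>\<in>G. blinfun_apply \<phi> e = 0" "blinfun_apply \<psi> e = 1"
      using e0 by (auto simp: e_def blinfun.scaleR_right)
    define K' where "K' = K + (1 + norm \<psi> * K) * norm e"
    have K': "K' \<ge> 0" using K by (simp add: K'_def)
    show ?thesis
    proof (intro exI[of _ K'] conjI allI K')
      fix w
      let ?s = "\<Sum>\<phi>\<in>G. \<bar>blinfun_apply \<phi> w\<bar>" and ?p = "\<bar>blinfun_apply \<psi> w\<bar>"
      obtain c where c: "\<forall>\<phi>\<in>G. blinfun_apply \<phi> c = blinfun_apply \<phi> w"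
        "norm c \<le> K * ?s" using K by metis
      define c' where "c' = c + (blinfun_apply \<psi> w - blinfun_apply \<psi> c) *\<^sub>R e"
      have s0: "?s \<ge> 0" by (intro sum_nonneg) auto
      have "\<bar>blinfun_apply \<psi> c\<bar> \<le> norm \<psi> * (K * ?s)"
        using norm_blinfun[of \<psi> c] c(2) by (smt (verit) mult_left_mono norm_ge_zero real_norm_def)
      then have "\<bar>blinfun_apply \<psi> w - blinfun_apply \<psi> c\<bar> \<le> ?p + norm \<psi> * K * ?s" by simp
      also have "\<dots> \<le> (1 + norm \<psi> * K) * (?p + ?s)"
        using K s0 by (simp add: algebra_simps)
      finally have "\<bar>blinfun_apply \<psi> w - blinfun_apply \<psi> c\<bar> * norm e \<le> (1 + norm \<psi> * K) * (?p + ?s) * norm e"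
        by (intro mult_right_mono) auto
      moreover have "K * ?s \<le> K * (?p + ?s)" using K by (intro mult_left_mono) auto
      moreover have "norm c' \<le> norm c + \<bar>blinfun_apply \<psi> w - blinfun_apply \<psi> c\<bar> * norm e"
        unfolding c'_def using norm_triangle_ineq by (metis norm_scaleR real_norm_def)
      ultimately have "norm c' \<le> K' * (?p + ?s)"
        using c(2) by (simp add: K'_def algebra_simps)
      then have "norm c' \<le> K' * (\<Sum>\<phi>\<in>insert \<psi> G. \<bar>blinfun_apply \<phi> w\<bar>)"
        using insert by simp
      moreover have "\<forall>\<phi>\<in>insert \<psi> G. blinfun_apply \<phi> c' = blinfun_apply \<phi> w"
        using e c by (auto simp: c'_def blinfun.add_right blinfun.scaleR_right)
      ultimately show "\<exists>c. (\<forall>\<phi>\<in>insert \<psi> G. blinfun_apply \<phi> c = blinfun_apply \<phi> w) \<and>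
          norm c \<le> K' * (\<Sum>\<phi>\<in>insert \<psi> G. \<bar>blinfun_apply \<phi> w\<bar>)" by blast
    qed
  qed
qed

section \<open>Descent for all active functionals at one point\<close>

text \<open>The hypothesis sends one functional in each dual face to minus infinity along one ray; the
  conclusion makes all active functionals small at one point. The proof is by induction on the number of
  active functionals. Let \<open>d t\<close> be the displacement along the ray of \<open>y\<close>, which has the same
  active functionals as \<open>x\<close>, and let \<open>G\<close> be the set of active functionals that stay
  bounded below on \<open>d t\<close>; it is not the whole active set because of \<open>\<psi>\<close>.

  The displacement exposes \<open>G\<close>: for large \<open>t\<close>, subtracting from \<open>d t\<close> a vector \<open>c\<close> of
  bounded norm gives a \<open>v\<close> on which \<open>G\<close> vanishes and the other active functionals are
  negative. So \<open>G\<close> is the active set of the unit vector \<open>y + s v\<close> for small \<open>s > 0\<close>, and the induction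
  hypothesis gives a point \<open>w\<close> for \<open>G\<close>. Then \<open>w + t y\<close> works for large \<open>t\<close>:
  moving along \<open>y\<close> does not increase the values of \<open>G\<close>, and sends the remaining ones to
  minus infinity.\<close>

lemma common_descent_point:
  fixes f :: "'a::real_normed_vector \<Rightarrow> 'a" and E :: "('a \<Rightarrow>\<^sub>L real) set"
  assumes E: "norming E" and f: "nonexpansive f"
    and decay: "\<And>x. norm x = 1 \<Longrightarrow> \<exists>x' (\<psi> :: 'a \<Rightarrow>\<^sub>L real). norm x' = 1 \<and> active E x' = active E x \<and>
      norm \<psi> \<le> 1 \<and> blinfun_apply \<psi> x' = 1 \<and>
      filterlim (\<lambda>t::real. blinfun_apply \<psi> (f (t *\<^sub>R x') - t *\<^sub>R x')) at_bot at_top"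
    and x: "norm x = 1"
  shows "\<exists>w. \<forall>\<phi>\<in>active E x. blinfun_apply \<phi> (f w - w) < - R"
  using x
proof (induction "card (active E x)" arbitrary: x rule: less_induct)
  case less
  obtain y and \<psi> :: "'a \<Rightarrow>\<^sub>L real" where y: "norm y = 1" "active E y = active E x" and \<psi>: "norm \<psi> \<le> 1" "blinfun_apply \<psi> y = 1"
    and lim: "filterlim (\<lambda>t::real. blinfun_apply \<psi> (f (t *\<^sub>R y) - t *\<^sub>R y)) at_bot at_top"
    using decay[OF less.prems] by blast
  define A where "A = active E y"
  define d where "d t = f (t *\<^sub>R y) - t *\<^sub>R y" for t :: real
  have finA: "finite A" using finite_active[OF E] by (simp add: A_def)
  have A1: "norm \<phi> \<le> 1" "blinfun_apply \<phi> y = 1" if "\<phi> \<in> A" for \<phi>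
    using that E y by (auto simp: A_def active_def norming_def)
  have mono: "blinfun_apply \<phi> (d t) \<le> blinfun_apply \<phi> (d s)" if "\<phi> \<in> A" "s \<le> t" for \<phi> s t
    using displacement_along_active[OF f E, of \<phi> y "t - s" "s *\<^sub>R y"] that
    by (simp add: d_def A_def algebra_simps)
  define G where "G = {\<phi>\<in>A. \<exists>M. \<forall>t\<ge>0. - M \<le> blinfun_apply \<phi> (d t)}"
  obtain M where M: "\<And>\<phi> t. \<phi> \<in> G \<Longrightarrow> t \<ge> 0 \<Longrightarrow> - M \<le> blinfun_apply \<phi> (d t)"
  proof -
    have "\<forall>\<phi>\<in>G. \<exists>M. \<forall>t\<ge>0. - M \<le> blinfun_apply \<phi> (d t)" by (simp add: G_def)
    then obtain m where m: "\<And>\<phi>. \<phi> \<in> G \<Longrightarrow> \<forall>t\<ge>0. - m \<phi> \<le> blinfun_apply \<phi> (d t)"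
      by (elim bchoice[THEN exE]) auto
    have "finite (m ` G)" using finA by (simp add: G_def)
    then have "m \<phi> \<le> Max (m ` G)" if "\<phi> \<in> G" for \<phi> using that by simp
    with m that show ?thesis by (metis dual_order.trans le_imp_neg_le)
  qed
  have escape: "\<forall>\<^sub>F t in at_top. \<forall>\<phi>\<in>A - G. blinfun_apply \<phi> (d t) < - Z" for Z
  proof -
    have "\<forall>\<^sub>F t in at_top. blinfun_apply \<phi> (d t) < - Z" if "\<phi> \<in> A - G" for \<phi>
    proof -
      have "\<not> (\<forall>t\<ge>0. - Z \<le> blinfun_apply \<phi> (d t))" using that by (auto simp: G_def)
      then obtain s where s: "blinfun_apply \<phi> (d s) < - Z" by (auto simp: not_le)
      have "blinfun_apply \<phi> (d t) < - Z" if "s \<le> t" for t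
        using mono[of \<phi> s t] \<open>\<phi> \<in> A - G\<close> s that by simp
      then show ?thesis by (auto simp: eventually_at_top_linorder)
    qed
    then show ?thesis using finA by (simp add: eventually_ball_finite)
  qed
  have "G \<noteq> A"
  proof
    assume "G = A"
    have "\<forall>\<^sub>F t in at_top. blinfun_apply \<psi> (d t) < - M"
      using lim by (simp add: filterlim_at_bot_dense d_def)
    moreover have "\<forall>\<^sub>F t in at_top. (t::real) \<ge> 0" by (rule eventually_ge_at_top)
    ultimately obtain t where t: "t \<ge> 0" "blinfun_apply \<psi> (d t) < - M"
      using eventually_happens'[OF trivial_limit_at_top_linorder] eventually_conj by (metis (mono_tags, lifting))
    obtain \<phi> where "\<phi> \<in> A" "blinfun_apply \<phi> (d t) \<le> blinfun_apply \<psi> (d t)"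
      using active_functional_below[OF E y(1) \<psi>] by (metis A_def)
    then show False using M[of \<phi> t] t \<open>G = A\<close> by simp
  qed
  have "\<exists>w. \<forall>\<phi>\<in>G. blinfun_apply \<phi> (f w - w) < - R"
  proof (cases "G = {}")
    case False
    then obtain \<phi>0 where \<phi>0: "\<phi>0 \<in> G" by blast
    have finG: "finite G" using finA by (simp add: G_def)
    obtain K where K: "K \<ge> 0" "\<And>w. \<exists>c. (\<forall>\<phi>\<in>G. blinfun_apply \<phi> c = blinfun_apply \<phi> w) \<and>
      norm c \<le> K * (\<Sum>\<phi>\<in>G. \<bar>blinfun_apply \<phi> w\<bar>)" using bounded_lift[OF finG] by metis
    \<comment> \<open>\<open>D\<close> bounds the norm of the correction \<open>c\<close> uniformly in \<open>t\<close>.\<close>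
    define D where "D = K * (\<Sum>\<phi>\<in>G. max M (norm (f 0)))"
    have "\<forall>\<^sub>F t in at_top. (t::real) \<ge> 0" by (rule eventually_ge_at_top)
    then obtain t where t: "t \<ge> 0" "\<And>\<phi>. \<phi> \<in> A - G \<Longrightarrow> blinfun_apply \<phi> (d t) < - D"
      using eventually_happens'[OF trivial_limit_at_top_linorder eventually_conj[OF escape[of D]]] by blast
    obtain c where c: "\<And>\<phi>. \<phi> \<in> G \<Longrightarrow> blinfun_apply \<phi> c = blinfun_apply \<phi> (d t)"
      "norm c \<le> K * (\<Sum>\<phi>\<in>G. \<bar>blinfun_apply \<phi> (d t)\<bar>)" using K by metis
    have "\<bar>blinfun_apply \<phi> (d t)\<bar> \<le> max M (norm (f 0))" if "\<phi> \<in> G" for \<phi>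
    proof -
      have \<phi>: "\<phi> \<in> A" using that by (simp add: G_def)
      have "blinfun_apply \<phi> (d t) \<le> norm (f 0)"
        using mono[OF \<phi> t(1)] functional_le[OF A1(1)[OF \<phi>], of "f 0"] by (simp add: d_def)
      with M[OF that t(1)] show ?thesis by linarith
    qed
    then have cD: "norm c \<le> D"
      unfolding D_def using K by (intro order_trans[OF c(2)] mult_left_mono sum_mono) auto
    define v where "v = d t - c"
    have v0: "blinfun_apply \<phi> v = 0" if "\<phi> \<in> G" for \<phi>
      using c that by (simp add: v_def blinfun.diff_right)
    have v1: "blinfun_apply \<phi> v < 0" if "\<phi> \<in> A - G" for \<phi>
    proof -
      have "blinfun_apply \<phi> (- c) \<le> norm (- c)" by (rule functional_le) (use A1 that in auto)
      then show ?thesis using t(2)[OF that] cD by (simp add: v_def blinfun.diff_right blinfun.minus_right)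
    qed
    have lim: "((\<lambda>s. y + s *\<^sub>R v) \<longlongrightarrow> y) (at_right 0)"
      by (rule tendsto_eq_intros refl tendsto_ident_at | simp)+
    have "\<forall>\<^sub>F s in at_right (0::real). 0 < s" by (rule eventually_at_right_less)
    then obtain s where s: "s > 0" "active E (y + s *\<^sub>R v) \<subseteq> A"
      using eventually_happens'[OF trivial_limit_at_right_real
          eventually_conj[OF eventually_active_subset[OF E lim]]] by (auto simp: A_def)
    let ?y = "y + s *\<^sub>R v"
    have val: "blinfun_apply \<phi> ?y = 1 + s * blinfun_apply \<phi> v" if "\<phi> \<in> A" for \<phi>
      using A1[OF that] by (simp add: blinfun.add_right blinfun.scaleR_right)
    have GA: "G \<subseteq> A" by (auto simp: G_def)
    have G_val: "blinfun_apply \<phi> ?y = 1" if "\<phi> \<in> G" for \<phi> using val v0 that GA by auto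
    have ge1: "norm ?y \<ge> 1" using G_val[OF \<phi>0] functional_le[OF A1(1), of \<phi>0 ?y] \<phi>0 GA by auto
    have sub: "active E ?y \<subseteq> G"
    proof
      fix \<phi> assume \<phi>: "\<phi> \<in> active E ?y"
      show "\<phi> \<in> G"
      proof (rule ccontr)
        assume "\<phi> \<notin> G"
        then have "\<phi> \<in> A - G" using \<phi> s by blast
        then have "blinfun_apply \<phi> ?y < 1" using val[of \<phi>] mult_pos_neg[OF s(1) v1[of \<phi>]] by simp
        then show False using \<phi> ge1 by (simp add: active_def)
      qed
    qed
    have "?y \<noteq> 0" using ge1 by auto
    then obtain \<phi>1 where "\<phi>1 \<in> active E ?y" using active_nonempty[OF E] by blast
    then have y1: "norm ?y = 1" using sub G_val by (metis (mono_tags, lifting) active_def mem_Collect_eq subsetD)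
    have eqG: "active E ?y = G"
      using sub G_val y1 GA by (auto simp: active_def A_def)
    have "card (active E ?y) < card (active E x)"
      using psubset_card_mono[OF finA, of G] GA \<open>G \<noteq> A\<close> eqG y(2) by (auto simp: A_def)
    from less.hyps[OF this y1] show ?thesis by (simp add: eqG)
  qed simp
  then obtain w where w: "\<And>\<phi>. \<phi> \<in> G \<Longrightarrow> blinfun_apply \<phi> (f w - w) < - R" by blast
  have "\<forall>\<^sub>F t in at_top. (t::real) \<ge> 0" by (rule eventually_ge_at_top)
  then obtain t where t: "t \<ge> 0" "\<And>\<phi>. \<phi> \<in> A - G \<Longrightarrow> blinfun_apply \<phi> (d t) < - (R + 2 * norm w)"
    using eventually_happens'[OF trivial_limit_at_top_linorder eventually_conj[OF escape[of "R + 2 * norm w"]]] by blast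
  let ?w = "w + t *\<^sub>R y"
  have "blinfun_apply \<phi> (f ?w - ?w) < - R" if \<phi>: "\<phi> \<in> A" for \<phi>
  proof (cases "\<phi> \<in> G")
    case True
    show ?thesis
      using displacement_along_active[OF f E, of \<phi> y t w] w[OF True] \<phi> t by (simp add: A_def)
  next
    case False
    have "norm (f ?w - f (t *\<^sub>R y)) \<le> norm w"
      using f[unfolded nonexpansive_def, rule_format, of ?w "t *\<^sub>R y"] by simp
    then have "norm ((f ?w - f (t *\<^sub>R y)) - w) \<le> 2 * norm w"
      using norm_triangle_ineq4[of "f ?w - f (t *\<^sub>R y)" w] by simp
    then have "blinfun_apply \<phi> ((f ?w - f (t *\<^sub>R y)) - w) \<le> 2 * norm w"
      using functional_le[OF A1(1)[OF \<phi>]] order_trans by blast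
    moreover have "f ?w - ?w = d t + ((f ?w - f (t *\<^sub>R y)) - w)" by (simp add: d_def)
    then have "blinfun_apply \<phi> (f ?w - ?w) = blinfun_apply \<phi> (d t) + blinfun_apply \<phi> ((f ?w - f (t *\<^sub>R y)) - w)"
      by (simp only: blinfun.add_right)
    ultimately show ?thesis using t(2)[of \<phi>] \<phi> False by simp
  qed
  then show ?case using y(2) by (auto simp: A_def)
qed

section \<open>Existence of a fixed point\<close>

text \<open>The contractions \<open>r n * f\<close> with \<open>r n\<close> tending to \<open>1\<close> have fixed points
  \<open>x n\<close>. If these are bounded, a limit point is fixed by \<open>f\<close>. Otherwise their directions
  accumulate at a unit vector \<open>y\<close>; take \<open>w\<close> for \<open>y\<close>. For a large \<open>x n\<close> in nearly
  this direction, a functional active at \<open>x n - w\<close> is active at \<open>y\<close>, so its value on the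
  displacement at \<open>x n\<close> is at most that at \<open>w\<close>, which is negative. But the displacement at
  \<open>x n\<close> is a nonnegative multiple of \<open>x n\<close>, on which that functional is
  nonnegative.\<close>

lemma fixed_point_if_descent:
  fixes f :: "'a::banach \<Rightarrow> 'a" and E :: "('a \<Rightarrow>\<^sub>L real) set"
  assumes E: "norming E" and comp: "compact (cball (0::'a) 1)" and f: "nonexpansive f"
    and descent: "\<And>x. norm x = 1 \<Longrightarrow> \<exists>w. \<forall>\<phi>\<in>active E x. blinfun_apply \<phi> (f w - w) < 0"
  shows "\<exists>z. f z = z"
proof -
  define r where "r n = 1 - inverse (real (n + 2))" for n
  have r: "0 < r n" "r n < 1" for n by (auto simp: r_def field_simps)
  have "\<exists>x. r n *\<^sub>R f x = x" for n
  proof -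
    have "\<exists>!x. r n *\<^sub>R f x = x"
    proof (rule banach_fix_type)
      show "\<forall>x y. dist (r n *\<^sub>R f x) (r n *\<^sub>R f y) \<le> r n * dist x y"
        using f r[of n] by (auto simp: dist_norm nonexpansive_def simp flip: scaleR_diff_right)
    qed (use r[of n] in auto)
    then show ?thesis by blast
  qed
  then obtain x where x: "\<And>n. r n *\<^sub>R f (x n) = x n" by metis
  show ?thesis
  proof (cases "\<exists>B. \<forall>n. norm (x n) \<le> B")
    case True
    then obtain B where B: "\<And>n. norm (x n) \<le> B" by blast
    \<comment> \<open>A positive radius makes the ball a scaled copy of the unit ball.\<close>
    define C where "C = max B 1"
    have "cball (0::'a) C = (*\<^sub>R) C ` cball 0 1"
      using cball_scale[of C "0::'a" 1] by (simp add: C_def)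
    then have "compact (cball (0::'a) C)" using compact_scaling[OF comp, of C] by simp
    moreover have "\<forall>n. x n \<in> cball 0 C" using B by (simp add: C_def le_max_iff_disj)
    ultimately obtain l k where k: "strict_mono (k :: nat \<Rightarrow> nat)" "(x \<circ> k) \<longlonglongrightarrow> l"
      unfolding compact_def by blast
    have "r \<longlonglongrightarrow> 1 - 0" unfolding r_def
      by (intro tendsto_diff tendsto_const LIMSEQ_ignore_initial_segment[OF lim_inverse_n])
    then have "(r \<circ> k) \<longlonglongrightarrow> 1" using LIMSEQ_subseq_LIMSEQ[OF _ k(1)] by auto
    moreover have "(\<lambda>n. f ((x \<circ> k) n)) \<longlonglongrightarrow> f l"
    proof (rule Lim_transform2)
      have "(\<lambda>n. norm ((x \<circ> k) n - l)) \<longlonglongrightarrow> 0"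
        by (rule tendsto_norm_zero[OF LIM_zero]) (use k(2) in \<open>simp add: o_def\<close>)
      then have "(\<lambda>n. f ((x \<circ> k) n) - f l) \<longlonglongrightarrow> 0"
        by (rule Lim_null_comparison[rotated]) (use f in \<open>auto simp: nonexpansive_def\<close>)
      then show "(\<lambda>n. f l - f ((x \<circ> k) n)) \<longlonglongrightarrow> 0"
        using tendsto_minus by fastforce
    qed simp
    ultimately have "(\<lambda>n. (r \<circ> k) n *\<^sub>R f ((x \<circ> k) n)) \<longlonglongrightarrow> 1 *\<^sub>R f l"
      by (rule tendsto_scaleR)
    then have "(x \<circ> k) \<longlonglongrightarrow> f l" by (simp add: x o_def)
    with k(2) show ?thesis using LIMSEQ_unique by blast
  next
    case False
    then have "\<exists>n. norm (x n) > real m" for m by (meson not_le)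
    then obtain n where n: "\<And>m. norm (x (n m)) > real m" by metis
    define u where "u m = x (n m)" for m
    have u: "norm (u m) > real m" for m using n by (simp add: u_def)
    have u0: "norm (u m) > 0" for m using u[of m] by (rule le_less_trans[rotated]) simp
    have "\<forall>m. u m /\<^sub>R norm (u m) \<in> cball 0 1" using u0 by (auto simp: field_simps)
    then obtain y k where k: "strict_mono (k :: nat \<Rightarrow> nat)" "((\<lambda>m. u m /\<^sub>R norm (u m)) \<circ> k) \<longlonglongrightarrow> y"
      using comp unfolding compact_def by (metis (no_types, lifting))
    have k': "(\<lambda>m. u (k m) /\<^sub>R norm (u (k m))) \<longlonglongrightarrow> y" using k(2) by (simp add: o_def)
    have "(\<lambda>m. norm (u (k m) /\<^sub>R norm (u (k m)))) \<longlonglongrightarrow> norm y" by (intro tendsto_norm k')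
    moreover have "norm (u (k m) /\<^sub>R norm (u (k m))) = 1" for m using u0[of "k m"] by simp
    ultimately have y: "norm y = 1" by (simp add: LIMSEQ_const_iff)
    then obtain w where w: "\<And>\<phi>. \<phi> \<in> active E y \<Longrightarrow> blinfun_apply \<phi> (f w - w) < 0" using descent by blast
    have top: "filterlim (\<lambda>m. norm (u (k m))) at_top sequentially"
    proof (rule filterlim_at_top_mono[OF filterlim_real_sequentially])
      show "\<forall>\<^sub>F m in sequentially. real m \<le> norm (u (k m))"
        using u seq_suble[OF k(1)] by (intro always_eventually allI) (meson less_imp_le of_nat_mono order_trans)
    qed
    have "(\<lambda>m. u (k m) /\<^sub>R norm (u (k m)) - inverse (norm (u (k m))) *\<^sub>R w) \<longlonglongrightarrow> y - 0 *\<^sub>R w"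
      by (intro tendsto_intros k' tendsto_inverse_0_at_top top)
    then have lim: "(\<lambda>m. inverse (norm (u (k m))) *\<^sub>R (u (k m) - w)) \<longlonglongrightarrow> y"
      by (simp add: scaleR_diff_right)
    have "\<forall>\<^sub>F m in sequentially. norm (u (k m)) > 2 * norm w + 1"
      using top by (simp add: filterlim_at_top_dense)
    then obtain m where m: "norm (u (k m)) > 2 * norm w + 1"
      "active E (inverse (norm (u (k m))) *\<^sub>R (u (k m) - w)) \<subseteq> active E y"
      using eventually_happens'[OF trivial_limit_sequentially eventually_conj[OF _ eventually_active_subset[OF E lim]]] by blast
    define p where "p = u (k m)"
    have big: "norm (p - w) > norm w" using m(1) norm_triangle_ineq2[of p w] by (simp add: p_def)
    then have "p - w \<noteq> 0" by auto
    then obtain \<phi> where \<phi>: "\<phi> \<in> active E (p - w)" using active_nonempty[OF E] by blast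
    have "\<phi> \<in> active E y" using \<phi> m(2) u0[of "k m"] by (simp add: active_scaleR p_def subset_iff)
    have \<phi>1: "norm \<phi> \<le> 1" "blinfun_apply \<phi> (p - w) = norm (p - w)"
      using \<phi> E by (auto simp: active_def norming_def)
    have "blinfun_apply \<phi> (- w) \<le> norm w" using functional_le[OF \<phi>1(1), of "- w"] by simp
    then have pos: "blinfun_apply \<phi> p \<ge> 0"
      using \<phi>1(2) big by (simp add: blinfun.diff_right blinfun.minus_right)
    define \<rho> where "\<rho> = r (n (k m))"
    have \<rho>: "0 < \<rho>" "\<rho> < 1" using r by (auto simp: \<rho>_def)
    have "\<rho> *\<^sub>R f p = p" using x by (simp add: \<rho>_def p_def u_def)
    then have "\<rho> * blinfun_apply \<phi> (f p) = blinfun_apply \<phi> p" by (metis blinfun.scaleR_right real_scaleR_def)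
    then have "blinfun_apply \<phi> (f p) = blinfun_apply \<phi> p / \<rho>" using \<rho> by (simp add: field_simps)
    also have "\<dots> \<ge> blinfun_apply \<phi> p" using \<rho> pos mult_right_mono[of \<rho> 1 "blinfun_apply \<phi> p"] by (simp add: field_simps)
    finally have "0 \<le> blinfun_apply \<phi> (f p - p)" by (simp add: blinfun.diff_right)
    also have "\<dots> \<le> blinfun_apply \<phi> (f w - w)" by (rule nonexpansive_functional_le[OF f \<phi>1])
    also have "\<dots> < 0" using w \<open>\<phi> \<in> active E y\<close> by blast
    finally show ?thesis by simp
  qed
qed

section \<open>Surjectivity of the displacement\<close>

theorem theorem4p1:
  fixes f :: "'a::banach \<Rightarrow> 'a"
    and xF :: "'a set \<Rightarrow> 'a"
    and xF' :: "'a set \<Rightarrow> ('a \<Rightarrow>\<^sub>L real)"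
  assumes "finite_dim_space TYPE('a)"
    and "polyhedral_norm TYPE('a)"
    and "nonexpansive f"
    and "\<And>F. F \<in> proper_faces \<Longrightarrow> xF F \<in> rel_interior F"
    and "\<And>F. F \<in> proper_faces \<Longrightarrow> xF' F \<in> rel_interior (dual_face F)"
  shows "surj (\<lambda>x. f x - x) \<longleftrightarrow>
    (\<forall>F \<in> proper_faces.
       filterlim (\<lambda>t::real. blinfun_apply (xF' F) (f (t *\<^sub>R xF F) - t *\<^sub>R xF F)) at_bot at_top)"
proof -
  obtain E :: "('a \<Rightarrow>\<^sub>L real) set" where E: "norming E"
    using norming_exists assms(1,2) by blast
  have norm1: "norm (xF F) = 1" if "F \<in> proper_faces" for F
    using norm_proper_face[OF that] assms(4)[OF that] rel_interior_subset by blast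
  have dual: "xF' F \<in> rel_interior (duality_map (xF F))" if "F \<in> proper_faces" for F
    using assms(5)[OF that] dual_face_eq_duality_map[OF that assms(4)[OF that]] by simp
  show ?thesis
  proof
    assume "surj (\<lambda>x. f x - x)"
    then show "\<forall>F \<in> proper_faces.
       filterlim (\<lambda>t::real. blinfun_apply (xF' F) (f (t *\<^sub>R xF F) - t *\<^sub>R xF F)) at_bot at_top"
      using displacement_tends_to_minus_infinity[OF E assms(3)] norm1 dual by blast
  next
    assume lim: "\<forall>F \<in> proper_faces.
       filterlim (\<lambda>t::real. blinfun_apply (xF' F) (f (t *\<^sub>R xF F) - t *\<^sub>R xF F)) at_bot at_top"
    have decay: "\<exists>x' (\<psi> :: 'a \<Rightarrow>\<^sub>L real). norm x' = 1 \<and> active E x' = active E x \<and> norm \<psi> \<le> 1 \<and> blinfun_apply \<psi> x' = 1 \<and>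
      filterlim (\<lambda>t::real. blinfun_apply \<psi> (f (t *\<^sub>R x') - t *\<^sub>R x')) at_bot at_top" if x: "norm x = 1" for x
    proof -
      let ?F = "{z \<in> cball 0 1. \<forall>\<phi>\<in>active E x. blinfun_apply \<phi> z = 1}"
      have F: "?F \<in> proper_faces" using face_with_given_active_set(1)[OF E x] .
      have "xF' ?F \<in> duality_map (xF ?F)" using dual[OF F] rel_interior_subset by blast
      then have "norm (xF' ?F) \<le> 1" "blinfun_apply (xF' ?F) (xF ?F) = 1"
        using norm1[OF F] by (auto simp: duality_map_def)
      then show ?thesis
        using face_with_given_active_set(2)[OF E x assms(4)[OF F]] norm1[OF F] bspec[OF lim F] by blast
    qed
    \<comment> \<open>The value \<open>u\<close> is attained where \<open>f - u\<close> has a fixed point.\<close>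
    have "\<exists>z. u = f z - z" for u
    proof -
      define g where "g z = f z - u" for z
      have "nonexpansive g" using assms(3) by (simp add: nonexpansive_def g_def)
      moreover have "\<exists>w. \<forall>\<phi>\<in>active E x. blinfun_apply \<phi> (g w - w) < 0" if x: "norm x = 1" for x
      proof -
        obtain w where w: "\<And>\<phi>. \<phi> \<in> active E x \<Longrightarrow> blinfun_apply \<phi> (f w - w) < - norm u"
          using common_descent_point[OF E assms(3) decay x] by blast
        have "blinfun_apply \<phi> (g w - w) < 0" if \<phi>: "\<phi> \<in> active E x" for \<phi>
        proof -
          have "blinfun_apply \<phi> (- u) \<le> norm u"
            using norming_le[OF E, of \<phi> "- u"] \<phi> by (simp add: active_def)
          with w[OF \<phi>] show ?thesis by (simp add: g_def blinfun.diff_right blinfun.minus_right)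
        qed
        then show ?thesis by blast
      qed
      ultimately obtain z where "g z = z"
        using fixed_point_if_descent[OF E compact_unit_ball[OF assms(1)]] by blast
      then show ?thesis by (intro exI[of _ z]) (simp add: g_def algebra_simps)
    qed
    then show "surj (\<lambda>x. f x - x)" unfolding surj_def by blast
  qed
qed

end
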